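(* Let $(X,\mathcal{A})$ be a measurable space and $\mu$ a measure on $(X,\mathcal{A})$. The following statements are equivalent: (a) $L^\infty(\mu)=\mathcal{M}(X,\mathcal{A})$. (b) The essential supnorm topology on $L^\infty(\mu)$ is identical to the relative $m_\mu$-topology on it (the subspace topology inherited from $\mathcal{M}(X,\mathcal{A})$ with the $m_\mu$-topology). (c) The $m_\mu$-topology on $\mathcal{M}(X,\mathcal{A})$ is connected. (d) The $m_\mu$-topology on $\mathcal{M}(X,\mathcal{A})$ is first countable.
   Context: A measurable space $(X,\mathcal{A})$ is a nonempty set $X$ with a $\sigma$-algebra $\mathcal{A}$ of subsets of $X$. $\mathcal{M}(X,\mathcal{A})$ is the ring (pointwise operations) of all $\mathcal{A}$-measurable functions $f:X\to\mathbb{R}$; these are genuine functions, not classes modulo almost everywhere equality. A measure is countably additive on $\mathcal{A}$ with values in $[0,\infty]$ and $\mu(\emptyset)=0$. For $g\in\mathcal{M}(X,\mathcal{A})$ and a positive unit $u$ of $\mathcal{M}(X,\mathcal{A})$ (i.e. $u$ measurable with $u(x)>0$ for all $x\in X$), put $m_\mu(g,u)=\{f\in\mathcal{M}(X,\mathcal{A}): |f(x)-g(x)|<u(x)\text{ for }\mu\text{-almost every }x\in X\}$. The $m_\mu$-topology on $\mathcal{M}(X,\mathcal{A})$ is the unique topology in which, for each $g$, the sets $m_\mu(g,u)$ ($u$ ranging over positive units) form a base of open neighbourhoods of $g$. $L^\infty(\mu)=\{f\in\mathcal{M}(X,\mathcal{A}):\|f\|_\infty<\infty\}$, where $\|f\|_\infty=\inf\{M\geq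 0:\mu\{t\in X:|f(t)|>M\}=0\}$ (with $\inf\emptyset=\infty$). The essential supnorm topology on $L^\infty(\mu)$ is the topology induced by the pseudonorm $\|\cdot\|_\infty$. *)

theory Defs
  imports "HOL-Analysis.Analysis"
begin

text \<open>A measure space $(X,\mathcal{A},\mu)$ is a value \<open>M :: 'a measure\<close> with \<open>X = space M\<close>,
  $\mathcal{A}$ = \<open>sets M\<close> and $\mu$ = \<open>emeasure M\<close>.  Real functions on $X$ are represented by functions
  on the whole type that are \<^const>\<open>undefined\<close> outside \<open>space M\<close>, so that equality in
  \<open>meas_funs M\<close> is equality of functions on $X$.\<close>

definition meas_funs :: "'a measure \<Rightarrow> ('a \<Rightarrow> real) set" where
  "meas_funs M = borel_measurable M \<inter> extensional (space M)"

definition pos_units :: "'a measure \<Rightarrow> ('a \<Rightarrow> real) set" where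
  "pos_units M = {u \<in> meas_funs M. \<forall>x\<in>space M. 0 < u x}"

definition m_nbhd :: "'a measure \<Rightarrow> ('a \<Rightarrow> real) \<Rightarrow> ('a \<Rightarrow> real) \<Rightarrow> ('a \<Rightarrow> real) set" where
  "m_nbhd M g u = {f \<in> meas_funs M. AE x in M. \<bar>f x - g x\<bar> < u x}"

definition m_topology :: "'a measure \<Rightarrow> ('a \<Rightarrow> real) topology" where
  "m_topology M =
     topology (\<lambda>U. U \<subseteq> meas_funs M \<and> (\<forall>g\<in>U. \<exists>u\<in>pos_units M. m_nbhd M g u \<subseteq> U))"

text \<open>The infimum is taken in \<^typ>\<open>ennreal\<close>, so it is \<open>\<infinity>\<close> for the empty set.\<close>

definition ess_supnorm :: "'a measure \<Rightarrow> ('a \<Rightarrow> real) \<Rightarrow> ennreal" where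
  "ess_supnorm M f =
     Inf {ennreal c | c::real. 0 \<le> c \<and> emeasure M {t \<in> space M. \<bar>f t\<bar> > c} = 0}"

definition L_infty :: "'a measure \<Rightarrow> ('a \<Rightarrow> real) set" where
  "L_infty M = {f \<in> meas_funs M. ess_supnorm M f < \<infinity>}"

definition ess_ball :: "'a measure \<Rightarrow> ('a \<Rightarrow> real) \<Rightarrow> real \<Rightarrow> ('a \<Rightarrow> real) set" where
  "ess_ball M g e = {f \<in> L_infty M. ess_supnorm M (\<lambda>x. f x - g x) < ennreal e}"

definition ess_supnorm_topology :: "'a measure \<Rightarrow> ('a \<Rightarrow> real) topology" where
  "ess_supnorm_topology M =
     topology (\<lambda>U. U \<subseteq> L_infty M \<and> (\<forall>g\<in>U. \<exists>e>0. ess_ball M g e \<subseteq> U))"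

lemma restrict_meas_funs:
  assumes "f \<in> borel_measurable M"
  shows "restrict f (space M) \<in> meas_funs M"
proof -
  have "restrict f (space M) \<in> borel_measurable M \<longleftrightarrow> f \<in> borel_measurable M"
    by (rule measurable_cong) simp
  with assms show ?thesis by (simp add: meas_funs_def)
qed

lemma pos_units_min:
  assumes "u \<in> pos_units M" "v \<in> pos_units M"
  shows "restrict (\<lambda>x. min (u x) (v x)) (space M) \<in> pos_units M"
proof -
  have [measurable]: "u \<in> borel_measurable M" "v \<in> borel_measurable M"
    using assms by (auto simp: pos_units_def meas_funs_def)
  show ?thesis using assms by (auto simp: pos_units_def intro!: restrict_meas_funs)
qed

lemma pos_units_one: "restrict (\<lambda>_. 1) (space M) \<in> pos_units M"
  by (auto simp: pos_units_def intro!: restrict_meas_funs)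

lemma m_nbhd_min_subset:
  "m_nbhd M g (restrict (\<lambda>x. min (u x) (v x)) (space M)) \<subseteq> m_nbhd M g u \<inter> m_nbhd M g v"
proof
  fix f assume "f \<in> m_nbhd M g (restrict (\<lambda>x. min (u x) (v x)) (space M))"
  then have f: "f \<in> meas_funs M"
    and ae: "AE x in M. \<bar>f x - g x\<bar> < restrict (\<lambda>x. min (u x) (v x)) (space M) x"
    by (auto simp: m_nbhd_def)
  have "AE x in M. \<bar>f x - g x\<bar> < u x" "AE x in M. \<bar>f x - g x\<bar> < v x"
    using ae AE_space by (eventually_elim, simp)+
  with f show "f \<in> m_nbhd M g u \<inter> m_nbhd M g v"
    by (simp add: m_nbhd_def)
qed

lemma istopology_m_topology:
  "istopology (\<lambda>U. U \<subseteq> meas_funs M \<and> (\<forall>g\<in>U. \<exists>u\<in>pos_units M. m_nbhd M g u \<subseteq> U))"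
  unfolding istopology_def
proof (rule conjI; intro allI impI conjI ballI)
  fix S T g
  assume S: "S \<subseteq> meas_funs M \<and> (\<forall>g\<in>S. \<exists>u\<in>pos_units M. m_nbhd M g u \<subseteq> S)"
    and T: "T \<subseteq> meas_funs M \<and> (\<forall>g\<in>T. \<exists>u\<in>pos_units M. m_nbhd M g u \<subseteq> T)"
  show "S \<inter> T \<subseteq> meas_funs M" using S by blast
  assume "g \<in> S \<inter> T"
  then obtain u v where "u \<in> pos_units M" "v \<in> pos_units M" "m_nbhd M g u \<subseteq> S" "m_nbhd M g v \<subseteq> T"
    using S T by blast
  then show "\<exists>u\<in>pos_units M. m_nbhd M g u \<subseteq> S \<inter> T"
    using pos_units_min[of u M v] m_nbhd_min_subset[of M g u v] by blast
next
  fix K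
  assume K: "\<forall>U\<in>K. U \<subseteq> meas_funs M \<and> (\<forall>g\<in>U. \<exists>u\<in>pos_units M. m_nbhd M g u \<subseteq> U)"
  show "\<Union>K \<subseteq> meas_funs M" using K by blast
  fix g assume "g \<in> \<Union>K"
  then show "\<exists>u\<in>pos_units M. m_nbhd M g u \<subseteq> \<Union>K"
    using K by (meson Sup_upper UnionE order_trans)
qed

lemma openin_m_topology:
  "openin (m_topology M) U \<longleftrightarrow>
     U \<subseteq> meas_funs M \<and> (\<forall>g\<in>U. \<exists>u\<in>pos_units M. m_nbhd M g u \<subseteq> U)"
  unfolding m_topology_def by (simp add: topology_inverse'[OF istopology_m_topology])

lemma topspace_m_topology: "topspace (m_topology M) = meas_funs M"
proof -
  have "openin (m_topology M) (meas_funs M)"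
    using pos_units_one by (auto simp: openin_m_topology m_nbhd_def)
  then show ?thesis
    by (metis openin_m_topology openin_subset openin_topspace subset_antisym)
qed

lemma openin_m_nbhd:
  assumes g: "g \<in> meas_funs M" and u: "u \<in> pos_units M"
  shows "openin (m_topology M) (m_nbhd M g u)"
  unfolding openin_m_topology
proof (intro conjI ballI)
  show "m_nbhd M g u \<subseteq> meas_funs M" by (auto simp: m_nbhd_def)
  fix f assume f: "f \<in> m_nbhd M g u"
  define v where
    "v = restrict (\<lambda>x. if \<bar>f x - g x\<bar> < u x then u x - \<bar>f x - g x\<bar> else 1) (space M)"
  have [measurable]: "f \<in> borel_measurable M" "g \<in> borel_measurable M" "u \<in> borel_measurable M"
    using f g u by (auto simp: m_nbhd_def pos_units_def meas_funs_def)
  have "v \<in> pos_units M"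
    by (auto simp: v_def pos_units_def intro!: restrict_meas_funs)
  moreover have "m_nbhd M f v \<subseteq> m_nbhd M g u"
  proof
    fix h assume h: "h \<in> m_nbhd M f v"
    have "AE x in M. \<bar>f x - g x\<bar> < u x" "AE x in M. \<bar>h x - f x\<bar> < v x"
      using f h by (auto simp: m_nbhd_def)
    then have "AE x in M. \<bar>h x - g x\<bar> < u x"
      using AE_space by eventually_elim (auto simp: v_def)
    with h show "h \<in> m_nbhd M g u" by (simp add: m_nbhd_def)
  qed
  ultimately show "\<exists>v\<in>pos_units M. m_nbhd M f v \<subseteq> m_nbhd M g u" by blast
qed

lemma mem_m_nbhd:
  assumes "g \<in> meas_funs M" "u \<in> pos_units M"
  shows "g \<in> m_nbhd M g u"
  using assms by (auto simp: m_nbhd_def pos_units_def)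

text \<open>\<^const>\<open>m_topology\<close> is the unique topology in which the sets \<open>m_nbhd M g u\<close> form a base of
  open neighbourhoods of each \<open>g\<close>.\<close>

lemma m_topology_unique:
  "topspace T = meas_funs M \<and>
   (\<forall>g\<in>meas_funs M.
      (\<forall>u\<in>pos_units M. openin T (m_nbhd M g u) \<and> g \<in> m_nbhd M g u) \<and>
      (\<forall>U. openin T U \<and> g \<in> U \<longrightarrow> (\<exists>u\<in>pos_units M. m_nbhd M g u \<subseteq> U)))
   \<longleftrightarrow> T = m_topology M" (is "?L \<longleftrightarrow> ?R")
proof
  assume L: ?L
  have "openin T U \<longleftrightarrow> openin (m_topology M) U" for U
  proof
    assume "openin T U"
    then show "openin (m_topology M) U"
      using L openin_subset[of T U] by (fastforce simp: openin_m_topology)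
  next
    assume U: "openin (m_topology M) U"
    have "\<exists>V. openin T V \<and> g \<in> V \<and> V \<subseteq> U" if "g \<in> U" for g
      using U that L by (meson openin_m_topology subsetD)
    then show "openin T U" by (subst openin_subopen) blast
  qed
  then show ?R by (simp add: topology_eq)
next
  assume ?R
  then show ?L
    by (auto simp: topspace_m_topology openin_m_nbhd mem_m_nbhd) (auto simp: openin_m_topology)
qed

lemma istopology_ess_supnorm_topology:
  "istopology (\<lambda>U. U \<subseteq> L_infty M \<and> (\<forall>g\<in>U. \<exists>e>0. ess_ball M g e \<subseteq> U))"
  unfolding istopology_def
proof (rule conjI; intro allI impI conjI ballI)
  fix S T g
  assume S: "S \<subseteq> L_infty M \<and> (\<forall>g\<in>S. \<exists>e>0. ess_ball M g e \<subseteq> S)"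
    and T: "T \<subseteq> L_infty M \<and> (\<forall>g\<in>T. \<exists>e>0. ess_ball M g e \<subseteq> T)"
  show "S \<inter> T \<subseteq> L_infty M" using S by blast
  assume "g \<in> S \<inter> T"
  then obtain d e where "d > 0" "e > 0" "ess_ball M g d \<subseteq> S" "ess_ball M g e \<subseteq> T"
    using S T by blast
  moreover have "ess_ball M g (min d e) \<subseteq> ess_ball M g d \<inter> ess_ball M g e"
    by (auto simp: ess_ball_def elim!: less_le_trans intro!: ennreal_leI)
  ultimately show "\<exists>e>0. ess_ball M g e \<subseteq> S \<inter> T"
    by (intro exI[of _ "min d e"]) auto
next
  fix K
  assume K: "\<forall>U\<in>K. U \<subseteq> L_infty M \<and> (\<forall>g\<in>U. \<exists>e>0. ess_ball M g e \<subseteq> U)"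
  show "\<Union>K \<subseteq> L_infty M" using K by blast
  fix g assume "g \<in> \<Union>K"
  then show "\<exists>e>0. ess_ball M g e \<subseteq> \<Union>K"
    using K by (meson Sup_upper UnionE order_trans)
qed

lemma openin_ess_supnorm_topology:
  "openin (ess_supnorm_topology M) U \<longleftrightarrow>
     U \<subseteq> L_infty M \<and> (\<forall>g\<in>U. \<exists>e>0. ess_ball M g e \<subseteq> U)"
  unfolding ess_supnorm_topology_def
  by (simp add: topology_inverse'[OF istopology_ess_supnorm_topology])

end

theory Submission
  imports Defs
begin

text \<open>A function outside \<open>L_infty M\<close> yields a positive unit \<open>1 / (1 + \<bar>f\<bar>)\<close> that is not bounded
  away from \<open>0\<close>; so (a) says exactly that every positive unit is essentially bounded below by a
  positive constant, and then the two topologies agree, segments are paths, and constant units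
  \<open>1/n\<close> suffice as a neighbourhood base. Conversely, \<open>L_infty M\<close> is always
  \<open>m_topology\<close>-clopen, and given countably many units \<open>u n\<close> and an essentially unbounded \<open>f\<close>,
  the unit \<open>min {u n x | n. n \<le> \<bar>f x\<bar>} / 2\<close> defeats all of them by diagonalisation.\<close>

section \<open>Essential bounds as almost everywhere inequalities\<close>

lemma ess_supnorm_less_iff:
  assumes [measurable]: "f \<in> borel_measurable M"
  shows "ess_supnorm M f < b \<longleftrightarrow> (\<exists>c\<ge>0. ennreal c < b \<and> (AE x in M. \<bar>f x\<bar> \<le> c))"
proof -
  \<comment> \<open>The exceptional set is measurable, so its being null is an almost everywhere
    statement. A strict upper bound on the infimum then needs just one admissible constant below
    \<open>b\<close>; whether the infimum is attained does not matter.\<close>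
  have "emeasure M {t \<in> space M. \<bar>f t\<bar> > c} = 0 \<longleftrightarrow> (AE x in M. \<bar>f x\<bar> \<le> c)" for c
    by (subst AE_iff_measurable[OF _ refl]) (auto simp: not_le)
  then show ?thesis
    by (auto simp: ess_supnorm_def Inf_less_iff)
qed

lemma borel_measurable_meas_funs: "f \<in> meas_funs M \<Longrightarrow> f \<in> borel_measurable M"
  by (simp add: meas_funs_def)

lemma pos_units_meas_funs: "u \<in> pos_units M \<Longrightarrow> u \<in> meas_funs M"
  by (simp add: pos_units_def)

lemma L_infty_iff: "f \<in> L_infty M \<longleftrightarrow> f \<in> meas_funs M \<and> (\<exists>c. AE x in M. \<bar>f x\<bar> \<le> c)"
proof -
  \<comment> \<open>If the whole space is null, even a negative \<open>c\<close> satisfies the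
    premise; hence the witness \<open>max c 0\<close>.\<close>
  have "(\<exists>c\<ge>0. AE x in M. \<bar>f x\<bar> \<le> c)" if "AE x in M. \<bar>f x\<bar> \<le> c" for c
    using that by (intro exI[of _ "max c 0"]) auto
  then have "(\<exists>c\<ge>0. AE x in M. \<bar>f x\<bar> \<le> c) \<longleftrightarrow> (\<exists>c. AE x in M. \<bar>f x\<bar> \<le> c)"
    by blast
  then show ?thesis
    by (simp add: L_infty_def ess_supnorm_less_iff borel_measurable_meas_funs cong: conj_cong)
qed

lemma ess_ball_iff:
  assumes "g \<in> meas_funs M"
  shows "f \<in> ess_ball M g e \<longleftrightarrow>
    f \<in> L_infty M \<and> (\<exists>c\<ge>0. c < e \<and> (AE x in M. \<bar>f x - g x\<bar> \<le> c))"
proof (cases "f \<in> L_infty M")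
  case True
  then have "(\<lambda>x. f x - g x) \<in> borel_measurable M"
    using assms by (intro borel_measurable_diff borel_measurable_meas_funs) (simp_all add: L_infty_iff)
  then show ?thesis
    using True by (auto simp: ess_ball_def ess_supnorm_less_iff ennreal_less_iff)
qed (simp add: ess_ball_def)

section \<open>Constant units and the clopen set of essentially bounded functions\<close>

lemma pos_units_const: "0 < e \<Longrightarrow> restrict (\<lambda>_. e) (space M) \<in> pos_units M"
  by (auto simp: pos_units_def intro!: restrict_meas_funs)

lemma m_nbhd_const:
  "m_nbhd M g (restrict (\<lambda>_. e) (space M)) = {f \<in> meas_funs M. AE x in M. \<bar>f x - g x\<bar> < e}"
  unfolding m_nbhd_def by (intro Collect_cong conj_cong refl AE_cong) simp

text \<open>Adding 1 to an essential bound of either function gives one for the other. So a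
  neighbourhood of radius 1 never crosses between \<open>L_infty M\<close> and its complement, which
  makes both open.\<close>

lemma m_nbhd_one_bounded_iff:
  assumes "g \<in> meas_funs M" "f \<in> m_nbhd M g (restrict (\<lambda>_. 1) (space M))"
  shows "f \<in> L_infty M \<longleftrightarrow> g \<in> L_infty M"
proof -
  have f: "f \<in> meas_funs M" and ae: "AE x in M. \<bar>f x - g x\<bar> < 1"
    using assms(2) by (auto simp: m_nbhd_const)
  have "AE x in M. \<bar>f x\<bar> \<le> c + 1" if "AE x in M. \<bar>g x\<bar> \<le> c" for c
    using ae that by eventually_elim linarith
  moreover have "AE x in M. \<bar>g x\<bar> \<le> c + 1" if "AE x in M. \<bar>f x\<bar> \<le> c" for c
    using ae that by eventually_elim linarith
  ultimately show ?thesis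
    using assms(1) f by (auto simp: L_infty_iff)
qed

lemma openin_L_infty: "openin (m_topology M) (L_infty M)"
  and closedin_L_infty: "closedin (m_topology M) (L_infty M)"
proof -
  let ?u = "restrict (\<lambda>_. 1) (space M)"
  have sub: "L_infty M \<subseteq> meas_funs M" by (auto simp: L_infty_iff)
  have "m_nbhd M g ?u \<subseteq> L_infty M" if "g \<in> L_infty M" for g
    using that sub m_nbhd_one_bounded_iff by blast
  then show "openin (m_topology M) (L_infty M)"
    using sub pos_units_one unfolding openin_m_topology by blast
  have "m_nbhd M g ?u \<subseteq> meas_funs M - L_infty M" if "g \<in> meas_funs M - L_infty M" for g
    using that m_nbhd_one_bounded_iff[of g M] by (auto simp: m_nbhd_def)
  then have "openin (m_topology M) (meas_funs M - L_infty M)"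
    using pos_units_one unfolding openin_m_topology by blast
  then show "closedin (m_topology M) (L_infty M)"
    using sub by (simp add: closedin_def topspace_m_topology)
qed

lemma zero_in_L_infty: "restrict (\<lambda>_. 0) (space M) \<in> L_infty M"
  by (auto simp: L_infty_iff intro!: restrict_meas_funs exI[of _ 0])

text \<open>The zero function rules out the empty set, so the clopen set \<open>L_infty M\<close>
  must be the whole space.\<close>

lemma connected_imp_bounded:
  assumes "connected_space (m_topology M)"
  shows "L_infty M = meas_funs M"
  using assms openin_L_infty[of M] closedin_L_infty[of M] zero_in_L_infty[of M]
  by (auto simp: connected_space_clopen_in topspace_m_topology)

section \<open>Essential lower bounds and comparison of the two topologies\<close>

lemma pos_unit_bounded_below:
  assumes "L_infty M = meas_funs M" "u \<in> pos_units M"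
  obtains d where "0 < d" "AE x in M. d \<le> u x"
proof -
  have [measurable]: "u \<in> borel_measurable M"
    using assms(2) by (simp add: pos_units_def meas_funs_def)
  \<comment> \<open>By (a) the reciprocal of \<open>u\<close> is essentially bounded, and an upper
    bound for it inverts to a lower bound for \<open>u\<close>.\<close>
  have "restrict (\<lambda>x. inverse (u x)) (space M) \<in> L_infty M"
    unfolding assms(1) by (intro restrict_meas_funs) measurable
  then obtain c where c: "AE x in M. \<bar>restrict (\<lambda>x. inverse (u x)) (space M) x\<bar> \<le> c"
    by (auto simp: L_infty_iff)
  \<comment> \<open>The \<open>max\<close> makes the lower bound positive whatever the sign of
    \<open>c\<close>.\<close>
  have "AE x in M. inverse (max c 1) \<le> u x"
    using c AE_space
  proof eventually_elim
    case (elim x)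
    then have "0 < u x" using assms(2) by (auto simp: pos_units_def)
    with elim have "inverse (u x) \<le> max c 1" by auto
    with \<open>0 < u x\<close> show ?case
      by (metis inverse_inverse_eq inverse_positive_iff_positive le_imp_inverse_le)
  qed
  then show ?thesis by (intro that[of "inverse (max c 1)"]) auto
qed

lemma ess_ball_subset_m_nbhd:
  assumes "g \<in> meas_funs M" "AE x in M. d \<le> u x"
  shows "ess_ball M g d \<subseteq> m_nbhd M g u"
proof
  fix f assume "f \<in> ess_ball M g d"
  then obtain c where "f \<in> L_infty M" "c < d" and ae: "AE x in M. \<bar>f x - g x\<bar> \<le> c"
    using assms(1) by (auto simp: ess_ball_iff)
  have "AE x in M. \<bar>f x - g x\<bar> < u x"
    using ae assms(2) by eventually_elim (use \<open>c < d\<close> in linarith)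
  with \<open>f \<in> L_infty M\<close> show "f \<in> m_nbhd M g u"
    by (simp add: m_nbhd_def L_infty_iff)
qed

text \<open>A strict almost everywhere bound by \<open>e\<close> would only give norm at most
  \<open>e\<close>; halving the constant recovers the strict inequality of the ball.\<close>

lemma m_nbhd_subset_ess_ball:
  assumes "g \<in> L_infty M" "0 < e"
  shows "m_nbhd M g (restrict (\<lambda>_. e / 2) (space M)) \<subseteq> ess_ball M g e"
proof
  have g: "g \<in> meas_funs M" using assms(1) by (simp add: L_infty_iff)
  fix f assume "f \<in> m_nbhd M g (restrict (\<lambda>_. e / 2) (space M))"
  then have f: "f \<in> meas_funs M" and ae: "AE x in M. \<bar>f x - g x\<bar> < e / 2"
    by (auto simp: m_nbhd_const)
  obtain c where "AE x in M. \<bar>g x\<bar> \<le> c" using assms(1) by (auto simp: L_infty_iff)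
  with ae have "AE x in M. \<bar>f x\<bar> \<le> c + e / 2" by eventually_elim linarith
  with f have "f \<in> L_infty M" by (auto simp: L_infty_iff)
  moreover have "AE x in M. \<bar>f x - g x\<bar> \<le> e / 2" using ae by eventually_elim simp
  ultimately show "f \<in> ess_ball M g e"
    using assms(2) by (auto simp: ess_ball_iff[OF g] intro!: exI[of _ "e / 2"])
qed

text \<open>At each point the two neighbourhood systems refine each other: a ball contains the
  neighbourhood of a constant unit, and the neighbourhood of \<open>u\<close> contains the ball
  whose radius is an essential lower bound of \<open>u\<close>.\<close>

lemma bounded_imp_topologies_eq:
  assumes "L_infty M = meas_funs M"
  shows "ess_supnorm_topology M = m_topology M"
  unfolding topology_eq
proof
  fix U
  have "(\<exists>e>0. ess_ball M g e \<subseteq> U) \<longleftrightarrow> (\<exists>u\<in>pos_units M. m_nbhd M g u \<subseteq> U)"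
    if g: "g \<in> meas_funs M" for g
  proof
    assume "\<exists>e>0. ess_ball M g e \<subseteq> U"
    then obtain e where "e > 0" "ess_ball M g e \<subseteq> U" by blast
    with m_nbhd_subset_ess_ball[of g M e] show "\<exists>u\<in>pos_units M. m_nbhd M g u \<subseteq> U"
      using g assms by (intro bexI[OF _ pos_units_const[of "e / 2"]]) auto
  next
    assume "\<exists>u\<in>pos_units M. m_nbhd M g u \<subseteq> U"
    then show "\<exists>e>0. ess_ball M g e \<subseteq> U"
      by (meson assms ess_ball_subset_m_nbhd g order_trans pos_unit_bounded_below)
  qed
  then show "openin (ess_supnorm_topology M) U \<longleftrightarrow> openin (m_topology M) U"
    unfolding openin_ess_supnorm_topology openin_m_topology assms by blast
qed

lemma topologies_eq_imp_bounded:
  assumes "ess_supnorm_topology M = subtopology (m_topology M) (L_infty M)"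
  shows "L_infty M = meas_funs M"
proof -
  have "f \<in> L_infty M" if f: "f \<in> meas_funs M" for f
  proof -
    define z :: "'a \<Rightarrow> real" where "z = restrict (\<lambda>_. 0) (space M)"
    define u where "u = restrict (\<lambda>x. 1 / (1 + \<bar>f x\<bar>)) (space M)"
    have [measurable]: "f \<in> borel_measurable M" by (rule borel_measurable_meas_funs[OF f])
    have z: "z \<in> L_infty M" unfolding z_def by (rule zero_in_L_infty)
    then have z': "z \<in> meas_funs M" by (simp add: L_infty_iff)
    have u: "u \<in> pos_units M"
      by (auto simp: u_def pos_units_def add_pos_nonneg intro!: restrict_meas_funs)
    have "openin (ess_supnorm_topology M) (m_nbhd M z u \<inter> L_infty M)"
      unfolding assms using openin_m_nbhd[OF z' u] by (auto simp: openin_subtopology)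
    moreover have "z \<in> m_nbhd M z u \<inter> L_infty M"
      using z mem_m_nbhd[OF z' u] by blast
    ultimately obtain e where e: "e > 0" "ess_ball M z e \<subseteq> m_nbhd M z u"
      unfolding openin_ess_supnorm_topology by (meson Int_subset_iff)
    \<comment> \<open>The constant \<open>e / 2\<close> lies in the ball around zero, hence within
      \<open>u\<close> of zero. This forces \<open>e / 2 < 1 / (1 + \<bar>f x\<bar>)\<close> almost
      everywhere, which bounds \<open>f\<close>.\<close>
    define k where "k = restrict (\<lambda>_. e / 2) (space M)"
    have "k \<in> L_infty M"
      using e(1) by (auto simp: k_def L_infty_iff intro!: restrict_meas_funs exI[of _ "e / 2"])
    moreover have "AE x in M. \<bar>k x - z x\<bar> \<le> e / 2"
      using e(1) by (intro AE_I2) (simp add: k_def z_def)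
    ultimately have "k \<in> ess_ball M z e"
      using e(1) by (auto simp: ess_ball_iff[OF z'] intro!: exI[of _ "e / 2"])
    with e(2) have "AE x in M. \<bar>k x - z x\<bar> < u x" by (auto simp: m_nbhd_def)
    then have "AE x in M. \<bar>f x\<bar> \<le> 2 / e"
      using AE_space
    proof eventually_elim
      case (elim x)
      then have "e / 2 < 1 / (1 + \<bar>f x\<bar>)" using e(1) by (simp add: k_def z_def u_def)
      then have "1 + \<bar>f x\<bar> < 2 / e" using e(1) by (simp add: field_simps)
      then show ?case by linarith
    qed
    with f show ?thesis by (auto simp: L_infty_iff)
  qed
  then show ?thesis by (auto simp: L_infty_iff)
qed

section \<open>Connectedness along segments\<close>

lemma bounded_imp_connected:
  assumes bd: "L_infty M = meas_funs M"
  shows "connected_space (m_topology M)"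
proof -
  have "path_connected_space (m_topology M)"
    unfolding path_connected_space_def topspace_m_topology
  proof (intro ballI)
    fix f g assume f: "f \<in> meas_funs M" and g: "g \<in> meas_funs M"
    note [measurable] = borel_measurable_meas_funs[OF f] borel_measurable_meas_funs[OF g]
    define p where "p = (\<lambda>t. restrict (\<lambda>x. f x + t * (g x - f x)) (space M))"
    have p: "p t \<in> meas_funs M" for t unfolding p_def by (intro restrict_meas_funs) measurable
    have "restrict (\<lambda>x. g x - f x) (space M) \<in> L_infty M"
      unfolding bd by (intro restrict_meas_funs) measurable
    then obtain c where c: "AE x in M. \<bar>restrict (\<lambda>x. g x - f x) (space M) x\<bar> \<le> c"
      by (auto simp: L_infty_iff)
    \<comment> \<open>Continuity of \<open>p\<close> is shown on the whole real line and restricted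
      to the unit interval afterwards.\<close>
    have "open {t. p t \<in> U}" if U: "openin (m_topology M) U" for U
      unfolding open_dist
    proof
      fix t assume "t \<in> {t. p t \<in> U}"
      then have "p t \<in> U" by simp
      then obtain u where u: "u \<in> pos_units M" "m_nbhd M (p t) u \<subseteq> U"
        using U by (auto simp: openin_m_topology)
      obtain d where d: "0 < d" "AE x in M. d \<le> u x"
        using pos_unit_bounded_below[OF bd u(1)] .
      \<comment> \<open>Points \<open>p s\<close> and \<open>p t\<close> differ by
        \<open>\<bar>s - t\<bar>\<close> times \<open>\<bar>g x - f x\<bar>\<close>, which is
        essentially at most \<open>c\<close>, so this radius keeps the difference below
        \<open>d\<close>. The \<open>max\<close> avoids dividing by a nonpositive
        \<open>c\<close>.\<close>
      show "\<exists>e>0. \<forall>s. dist s t < e \<longrightarrow> s \<in> {t. p t \<in> U}"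
      proof (intro exI[of _ "d / (max c 1)"] conjI allI impI)
        show "0 < d / max c 1" using d(1) by simp
        fix s assume "dist s t < d / max c 1"
        then have s: "\<bar>s - t\<bar> * max c 1 < d" by (simp add: dist_real_def field_simps)
        have "AE x in M. \<bar>p s x - p t x\<bar> < u x"
          using c d(2) AE_space
        proof eventually_elim
          case (elim x)
          have "\<bar>p s x - p t x\<bar> = \<bar>s - t\<bar> * \<bar>g x - f x\<bar>"
            using elim(3) by (simp add: p_def abs_mult[symmetric] algebra_simps)
          also have "\<dots> \<le> \<bar>s - t\<bar> * max c 1"
            using elim by (intro mult_left_mono) auto
          finally show ?case using s elim(2) by linarith
        qed
        with p u(2) show "s \<in> {t. p t \<in> U}" by (auto simp: m_nbhd_def)
      qed
    qed
    then have "continuous_map euclidean (m_topology M) p"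
      using p by (auto simp: continuous_map_def topspace_m_topology)
    then have "pathin (m_topology M) p"
      unfolding pathin_def by (rule continuous_map_from_subtopology)
    moreover have "p 0 = f" "p 1 = g"
      using f g by (auto simp: p_def meas_funs_def extensional_restrict)
    ultimately show "\<exists>p. pathin (m_topology M) p \<and> p 0 = f \<and> p 1 = g" by blast
  qed
  then show ?thesis by (rule path_connected_imp_connected_space)
qed

section \<open>First countability\<close>

lemma bounded_imp_first_countable:
  assumes bd: "L_infty M = meas_funs M"
  shows "first_countable (m_topology M)"
  unfolding first_countable_def topspace_m_topology
proof
  fix g assume g: "g \<in> meas_funs M"
  define B where "B = (\<lambda>n. m_nbhd M g (restrict (\<lambda>_. 1 / real (Suc n)) (space M)))"
  have "\<exists>V\<in>range B. g \<in> V \<and> V \<subseteq> U" if U: "openin (m_topology M) U" "g \<in> U" for U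
  proof -
    obtain u where u: "u \<in> pos_units M" "m_nbhd M g u \<subseteq> U"
      using U by (auto simp: openin_m_topology)
    obtain d where d: "0 < d" "AE x in M. d \<le> u x"
      using pos_unit_bounded_below[OF bd u(1)] .
    obtain n where n: "1 / real (Suc n) < d" using nat_approx_posE[OF d(1)] by blast
    have "AE x in M. \<bar>f x - g x\<bar> < u x" if "AE x in M. \<bar>f x - g x\<bar> < 1 / real (Suc n)" for f
      using that d(2) by eventually_elim (use n in linarith)
    then have "B n \<subseteq> m_nbhd M g u"
      unfolding B_def m_nbhd_const unfolding m_nbhd_def by blast
    moreover have "g \<in> B n" unfolding B_def by (intro mem_m_nbhd g pos_units_const) simp
    ultimately show ?thesis using u(2) by blast
  qed
  moreover have "openin (m_topology M) (B n)" for n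
    unfolding B_def by (intro openin_m_nbhd g pos_units_const) simp
  ultimately show "\<exists>\<B>. countable \<B> \<and> (\<forall>V\<in>\<B>. openin (m_topology M) V) \<and>
      (\<forall>U. openin (m_topology M) U \<and> g \<in> U \<longrightarrow> (\<exists>V\<in>\<B>. g \<in> V \<and> V \<subseteq> U))"
    by (intro exI[of _ "range B"]) auto
qed

text \<open>Each point imposes only the finitely many constraints with \<open>n\<close> at most
  \<open>\<bar>f x\<bar>\<close>, so the infinitely many units can be undercut at once by a
  pointwise finite minimum that stays positive.\<close>

lemma diagonal_pos_unit:
  fixes u :: "nat \<Rightarrow> 'a \<Rightarrow> real"
  assumes f: "f \<in> meas_funs M" and u: "\<And>n. u n \<in> pos_units M"
  shows "\<exists>v\<in>pos_units M. \<forall>n. \<forall>x\<in>space M. real n \<le> \<bar>f x\<bar> \<longrightarrow> v x \<le> u n x / 2"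
proof -
  define N where "N = (\<lambda>x. nat \<lfloor>\<bar>f x\<bar>\<rfloor>)"
  \<comment> \<open>The index 0 always occurs, so the minimum is over a nonempty set.\<close>
  define v where "v = restrict (\<lambda>x. (MIN n\<in>{..N x}. u n x) / 2) (space M)"
  have [measurable]: "f \<in> borel_measurable M" "\<And>n. u n \<in> borel_measurable M"
    using f u by (auto intro!: borel_measurable_meas_funs pos_units_meas_funs)
  have [measurable]: "N \<in> M \<rightarrow>\<^sub>M count_space UNIV" unfolding N_def by measurable
  have [measurable]: "(\<lambda>x. MIN n\<in>{..k}. u n x) \<in> borel_measurable M" for k :: nat
    by (rule borel_measurable_Min) auto
  \<comment> \<open>The index range varies with \<open>x\<close>, but \<open>N\<close> is measurable
    with countably many values, and for each fixed value the minimum is measurable.\<close>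
  have "(\<lambda>x. MIN n\<in>{..N x}. u n x) \<in> borel_measurable M"
    by (rule measurable_compose_countable[where g = N]) measurable
  then have "v \<in> meas_funs M" unfolding v_def by (intro restrict_meas_funs) measurable
  moreover have "0 < v x" if "x \<in> space M" for x
    using that u by (auto simp: v_def pos_units_def)
  ultimately have "v \<in> pos_units M" by (simp add: pos_units_def)
  moreover have "v x \<le> u n x / 2" if "x \<in> space M" "real n \<le> \<bar>f x\<bar>" for n x
  proof -
    have "n \<le> N x" using that(2) by (simp add: N_def le_nat_floor)
    then show ?thesis using that(1) by (auto simp: v_def intro!: Min_le)
  qed
  ultimately show ?thesis by blast
qed

lemma first_countable_imp_bounded:
  assumes "first_countable (m_topology M)"
  shows "L_infty M = meas_funs M"
proof -
  have "f \<in> L_infty M" if f: "f \<in> meas_funs M" for f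
  proof -
    define z :: "'a \<Rightarrow> real" where "z = restrict (\<lambda>_. 0) (space M)"
    have z: "z \<in> meas_funs M" unfolding z_def by (intro restrict_meas_funs) measurable
    obtain \<B> where \<B>: "countable \<B>"
      and nb: "\<And>U. openin (m_topology M) U \<Longrightarrow> z \<in> U \<Longrightarrow> \<exists>V\<in>\<B>. z \<in> V \<and> V \<subseteq> U"
      and op: "\<And>V. V \<in> \<B> \<Longrightarrow> openin (m_topology M) V"
      using assms z unfolding first_countable_def topspace_m_topology by metis
    \<comment> \<open>Members of the local base need not contain \<open>z\<close>; only those that
      do contain a neighbourhood \<open>m_nbhd M z u\<close>.\<close>
    define \<C> where "\<C> = {V \<in> \<B>. z \<in> V}"
    have "countable \<C>" using \<B> by (simp add: \<C>_def)
    have "\<C> \<noteq> {}" using nb[OF openin_topspace] z by (auto simp: \<C>_def topspace_m_topology)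
    then have range: "range (from_nat_into \<C>) = \<C>"
      using \<open>countable \<C>\<close> by (rule range_from_nat_into)
    have "\<exists>u\<in>pos_units M. m_nbhd M z u \<subseteq> from_nat_into \<C> n" for n
    proof -
      have "from_nat_into \<C> n \<in> \<C>" using range by blast
      then show ?thesis using op by (auto simp: \<C>_def openin_m_topology)
    qed
    then obtain u where u: "\<And>n. u n \<in> pos_units M"
      and sub: "\<And>n. m_nbhd M z (u n) \<subseteq> from_nat_into \<C> n" by metis
    obtain v where v: "v \<in> pos_units M"
      and diag: "\<forall>n. \<forall>x\<in>space M. real n \<le> \<bar>f x\<bar> \<longrightarrow> v x \<le> u n x / 2"
      using diagonal_pos_unit[where u = u, OF f u] by blast
    obtain V where V: "V \<in> \<B>" "z \<in> V" "V \<subseteq> m_nbhd M z v"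
      using nb[OF openin_m_nbhd[OF z v] mem_m_nbhd[OF z v]] by blast
    then have "V \<in> range (from_nat_into \<C>)" unfolding range by (simp add: \<C>_def)
    then obtain n where "from_nat_into \<C> n = V" by blast
    with sub[of n] V(3) have nv: "m_nbhd M z (u n) \<subseteq> m_nbhd M z v" by simp
    \<comment> \<open>Half of \<open>u n\<close> is strictly below \<open>u n\<close> everywhere,
      yet at least \<open>v\<close> wherever \<open>n\<close> is at most
      \<open>\<bar>f x\<bar>\<close>. Since \<open>h\<close> must also be almost everywhere below
      \<open>v\<close>, that set is null, so \<open>n\<close> is an essential bound for
      \<open>f\<close>.\<close>
    define h where "h = restrict (\<lambda>x. u n x / 2) (space M)"
    note [measurable] = borel_measurable_meas_funs[OF pos_units_meas_funs[OF u[of n]]]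
    have "h \<in> meas_funs M" unfolding h_def by (intro restrict_meas_funs) measurable
    moreover have "AE x in M. \<bar>h x - z x\<bar> < u n x"
      using u[of n] by (intro AE_I2) (auto simp add: abs_of_pos h_def z_def pos_units_def)
    ultimately have "h \<in> m_nbhd M z (u n)" by (simp add: m_nbhd_def)
    with nv have "h \<in> m_nbhd M z v" by blast
    then have "AE x in M. \<bar>h x - z x\<bar> < v x" by (simp add: m_nbhd_def)
    then have "AE x in M. \<bar>f x\<bar> \<le> real n"
      using AE_space
    proof eventually_elim
      case (elim x)
      show ?case
      proof (rule ccontr)
        assume "\<not> \<bar>f x\<bar> \<le> real n"
        then have "v x \<le> u n x / 2" using diag elim(2) by simp
        with elim show False by (simp add: h_def z_def)
      qed
    qed
    with f show ?thesis by (auto simp: L_infty_iff)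
  qed
  then show ?thesis by (auto simp: L_infty_iff)
qed

theorem theorem3p6:
  fixes M :: "'a measure"
  assumes "space M \<noteq> {}"
  shows "(L_infty M = meas_funs M
            \<longleftrightarrow> ess_supnorm_topology M = subtopology (m_topology M) (L_infty M))
       \<and> (L_infty M = meas_funs M \<longleftrightarrow> connected_space (m_topology M))
       \<and> (L_infty M = meas_funs M \<longleftrightarrow> first_countable (m_topology M))"
proof -
  \<comment> \<open>Under (a) the subspace is the whole space, so the relative topology is
    \<open>m_topology M\<close> itself.\<close>
  have "ess_supnorm_topology M = subtopology (m_topology M) (L_infty M)"
    if "L_infty M = meas_funs M"
    using bounded_imp_topologies_eq[OF that] that
    by (metis subtopology_topspace topspace_m_topology)
  then show ?thesis
    using topologies_eq_imp_bounded bounded_imp_connected connected_imp_bounded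
      bounded_imp_first_countable first_countable_imp_bounded by blast
qed

end
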